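(* Let $n\ge 2$ and $N_1,\dots,N_n\ge 1$ be integers, and let $G$ be a simple graph with at least one edge on the vertex set $\{v_{i_1,i_2,\dots,i_n} : 1\le i_k\le N_k \text{ for } k=1,\dots,n\}$. Suppose that $G$ is partially symmetric and satisfies the following conditions. (1) There is no edge between two vertices of the same layer $C_{i_1}$: $(v_{i_1,i_2,\dots,i_n},v_{i_1,j_2,\dots,j_n})\notin E(G)$ for all $i_1,i_2,\dots,i_n,j_2,\dots,j_n$. (2) For each level $r\in\{1,\dots,n-1\}$ and all index tuples with $(i_1,\dots,i_r)\ne(j_1,\dots,j_r)$ and $(k_1,\dots,k_r)\neq(l_1,\dots,l_r)$ (where $1\le i_t,j_t,k_t,l_t\le N_t$): if $A_{i_1\cdots i_r,\,j_1\cdots j_r}\ne 0$ and $A_{k_1\cdots k_r,\,l_1\cdots l_r}\ne 0$, then $A_{i_1\cdots i_r,\,j_1\cdots j_r}=A_{k_1\cdots k_r,\,l_1\cdots l_r}$. (That is, at each level $r$, any two distinct layers $C_{i_1,\dots,i_r}$ and $C_{j_1,\dots,j_r}$ either have no edge between them, or the block $A_{i_1\cdots i_r,\,j_1\cdots j_r}$ equals one common matrix.) (3) For each $i_1\in\{1,\dots,N_1\}$, all vertices in the layer $C_{i_1}$ have the same degree. Then $\rho_q(G)$ is fully separable in $\mathbb{C}^{N_1}\otimes\cdots\otimes\mathbb{C}^{N_n}$.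
   Context: Graphs are finite, undirected and simple (no loops, no multiple edges); an edge $(a,b)$ is the same as $(b,a)$. $D(G)$ is the diagonal degree matrix and $A(G)$ is the $0/1$ adjacency matrix. Put $Q(G)=D(G)+A(G)$ and define (for $G$ with at least one edge) $$\rho_q(G)=\frac{Q(G)}{\mathrm{tr}(Q(G))}.$$ The vertex $v_{i_1,\dots,i_n}$ is identified with the integer $(i_1-1)N_2N_3\cdots N_n+(i_2-1)N_3\cdots N_n+\cdots+(i_{n-1}-1)N_n+i_n$, so that the matrices above act on $\mathbb{C}^{N_1}\otimes\cdots\otimes\mathbb{C}^{N_n}$, with $v_{i_1,\dots,i_n}$ corresponding to the basis vector $e_{i_1}\otimes\cdots\otimes e_{i_n}$. Layers: for $1\le r\le n-1$ and indices $1\le i_t\le N_t$, the layer $C_{i_1,\dots,i_r}$ is the set of all vertices $v_{i_1,\dots,i_r,a_{r+1},\dots,a_n}$ whose first $r$ indices are $i_1,\dots,i_r$; it has $N_{r+1}\cdots N_n$ vertices. $A_{i_1\cdots i_r,\,j_1\cdots j_r}$ denotes the square block of $A(G)$ of size $N_{r+1}\cdots N_n$ with rows indexed by $C_{i_1,\dots,i_r}$ and columns indexed by $C_{j_1,\dots,j_r}$ (vertices ordered by their integer labels). Blocks are compared entrywise via these orderings. $G$ is partially symmetric if for all $i_1\neq j_1$ and all $i_2,\dots,i_n,j_2,\dots,j_n$: $(v_{i_1,i_2,\dots,i_n},v_{j_1,j_2,\dots,j_n})\in E(G)$ implies $(v_{j_1,i_2,\dots,i_n},v_{i_1,j_2,\dots,j_n})\in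 E(G)$. A density matrix is a positive semidefinite Hermitian matrix of trace $1$. A density matrix $\rho$ on $H_1\otimes\cdots\otimes H_n$ is fully separable if $\rho=\sum_i p_i\,\rho_i^1\otimes\cdots\otimes\rho_i^n$ (finite sum) with $p_i\ge 0$, $\sum_i p_i=1$, and each $\rho_i^j$ a density matrix on $H_j$. *)

theory Defs
  imports
    "Graph_Theory.Pair_Digraph"
    "Jordan_Normal_Form.Schur_Decomposition"
    "Jordan_Normal_Form.DL_Submatrix"
begin

subsection \<open>Multi-indices, labels and layers\<close>

definition multi_indices :: "nat list \<Rightarrow> nat list set" where
  "multi_indices Ns = {v. length v = length Ns \<and> (\<forall>k<length Ns. 1 \<le> v ! k \<and> v ! k \<le> Ns ! k)}"

text \<open>
  The vertex with multi-index \<open>[i\<^sub>1, \<dots>, i\<^sub>n]\<close> has the integer label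
  \<open>(i\<^sub>1 - 1) N\<^sub>2 \<cdots> N\<^sub>n + \<cdots> + (i\<^bsub>n-1\<^esub> - 1) N\<^sub>n + i\<^sub>n\<close>. Matrices are indexed
  from \<open>0\<close>, so \<open>vertex_index\<close> is this label minus one.
\<close>
definition vertex_index :: "nat list \<Rightarrow> nat list \<Rightarrow> nat" where
  "vertex_index Ns v = (\<Sum>k<length Ns. (v ! k - 1) * prod_list (drop (Suc k) Ns))"

definition vertex_at :: "nat list \<Rightarrow> nat \<Rightarrow> nat list" where
  "vertex_at Ns = the_inv_into (multi_indices Ns) (vertex_index Ns)"

definition layer :: "nat list \<Rightarrow> nat list \<Rightarrow> nat list set" where
  "layer Ns is = {v \<in> multi_indices Ns. take (length is) v = is}"

lemma vertex_index_Cons: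
  "vertex_index (N # Ns) (i # v) = (i - 1) * prod_list Ns + vertex_index Ns v"
  by (simp add: vertex_index_def sum.lessThan_Suc_shift del: sum.lessThan_Suc)

lemma multi_indices_Nil: "multi_indices [] = {[]}"
  by (auto simp: multi_indices_def)

lemma Cons_in_multi_indices:
  "i # v \<in> multi_indices (N # Ns) \<longleftrightarrow> i \<in> {1..N} \<and> v \<in> multi_indices Ns"
  by (auto simp: multi_indices_def nth_Cons less_Suc_eq_0_disj split: nat.splits)

lemma multi_indices_ConsE:
  assumes "w \<in> multi_indices (N # Ns)"
  obtains i v where "w = i # v" "i \<in> {1..N}" "v \<in> multi_indices Ns"
  using assms Cons_in_multi_indices
  by (cases w) (auto simp: multi_indices_def[of "N # Ns"], metis assms Cons_in_multi_indices)

lemma vertex_index_less: "v \<in> multi_indices Ns \<Longrightarrow> vertex_index Ns v < prod_list Ns"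
proof (induction Ns arbitrary: v)
  case Nil
  then show ?case by (simp add: vertex_index_def)
next
  case (Cons N Ns)
  then obtain i w where v: "v = i # w" "i \<in> {1..N}" "w \<in> multi_indices Ns"
    by (blast elim: multi_indices_ConsE)
  have "(i - 1) * prod_list Ns + vertex_index Ns w < (i - 1) * prod_list Ns + prod_list Ns"
    using Cons.IH v by simp
  also have "\<dots> = i * prod_list Ns"
    using v by (cases i) auto
  also have "\<dots> \<le> N * prod_list Ns"
    using v by (intro mult_right_mono) auto
  finally show ?case
    using v by (simp add: vertex_index_Cons)
qed

lemma bij_betw_vertex_index:
  "bij_betw (vertex_index Ns) (multi_indices Ns) {..<prod_list Ns}"
proof (rule bij_betwI')
  show "vertex_index Ns u = vertex_index Ns v \<longleftrightarrow> u = v"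
    if "u \<in> multi_indices Ns" "v \<in> multi_indices Ns" for u v
    using that
  proof (induction Ns arbitrary: u v)
    case Nil
    then show ?case by (simp add: multi_indices_Nil)
  next
    case (Cons N Ns)
    obtain i u' where u: "u = i # u'" "i \<in> {1..N}" "u' \<in> multi_indices Ns"
      using Cons.prems by (blast elim: multi_indices_ConsE)
    obtain j v' where v: "v = j # v'" "j \<in> {1..N}" "v' \<in> multi_indices Ns"
      using Cons.prems by (blast elim: multi_indices_ConsE)
    have less: "vertex_index Ns u' < prod_list Ns" "vertex_index Ns v' < prod_list Ns"
      using u v vertex_index_less by auto
    show ?case
    proof
      assume eq: "vertex_index (N # Ns) u = vertex_index (N # Ns) v"
      then have "vertex_index (N # Ns) u div prod_list Ns = vertex_index (N # Ns) v div prod_list Ns"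
        "vertex_index (N # Ns) u mod prod_list Ns = vertex_index (N # Ns) v mod prod_list Ns"
        by simp_all
      moreover have "prod_list Ns \<noteq> 0"
        using less by linarith
      ultimately have "i - 1 = j - 1" "vertex_index Ns u' = vertex_index Ns v'"
        using less u v by (simp_all add: vertex_index_Cons del: One_nat_def)
      then show "u = v"
        using Cons.IH u v by auto
    qed simp
  qed
next
  show "vertex_index Ns v \<in> {..<prod_list Ns}" if "v \<in> multi_indices Ns" for v
    using that vertex_index_less by simp
next
  show "\<exists>v\<in>multi_indices Ns. a = vertex_index Ns v" if "a \<in> {..<prod_list Ns}" for a
    using that
  proof (induction Ns arbitrary: a)
    case Nil
    then show ?case by (simp add: multi_indices_Nil vertex_index_def)
  next
    case (Cons N Ns)
    then have pos: "prod_list Ns > 0"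
      by (metis lessThan_iff mult_0_right neq0_conv not_less0 prod_list.Cons)
    then obtain w where w: "w \<in> multi_indices Ns" "a mod prod_list Ns = vertex_index Ns w"
      using Cons.IH[of "a mod prod_list Ns"] by auto
    have "a div prod_list Ns < N"
      using Cons.prems pos by (simp add: less_mult_imp_div_less)
    then have "Suc (a div prod_list Ns) # w \<in> multi_indices (N # Ns)"
      using w by (simp add: Cons_in_multi_indices)
    moreover have "a = vertex_index (N # Ns) (Suc (a div prod_list Ns) # w)"
      using w(2)[symmetric] by (simp add: vertex_index_Cons)
    ultimately show ?case by blast
  qed
qed

lemma vertex_at_vertex_index [simp]:
  "v \<in> multi_indices Ns \<Longrightarrow> vertex_at Ns (vertex_index Ns v) = v"
  unfolding vertex_at_def
  using bij_betw_vertex_index by (intro the_inv_into_f_f) (auto simp: bij_betw_def)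


subsection \<open>Matrices of a graph\<close>

text \<open>
  A finite simple undirected graph is a \<open>pair_graph\<close>: an undirected edge is represented by
  both of its orientations in \<open>parcs\<close>, so the degree of a vertex is its out-degree.
\<close>

definition adjacency_matrix :: "nat list \<Rightarrow> nat list pair_pre_digraph \<Rightarrow> complex mat" where
  "adjacency_matrix Ns G = mat (prod_list Ns) (prod_list Ns)
     (\<lambda>(a, b). if (vertex_at Ns a, vertex_at Ns b) \<in> parcs G then 1 else 0)"

definition degree_matrix :: "nat list \<Rightarrow> nat list pair_pre_digraph \<Rightarrow> complex mat" where
  "degree_matrix Ns G = mat (prod_list Ns) (prod_list Ns)
     (\<lambda>(a, b). if a = b then of_nat (out_degree (with_proj G) (vertex_at Ns a)) else 0)"

definition signless_laplacian :: "nat list \<Rightarrow> nat list pair_pre_digraph \<Rightarrow> complex mat" where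
  "signless_laplacian Ns G = degree_matrix Ns G + adjacency_matrix Ns G"

definition mat_trace :: "complex mat \<Rightarrow> complex" where
  "mat_trace A = (\<Sum>a<dim_row A. A $$ (a, a))"

definition rho_q :: "nat list \<Rightarrow> nat list pair_pre_digraph \<Rightarrow> complex mat" where
  "rho_q Ns G = (1 / mat_trace (signless_laplacian Ns G)) \<cdot>\<^sub>m signless_laplacian Ns G"

text \<open>\<open>submatrix\<close> keeps the selected rows and columns in increasing order of their index.\<close>
definition adjacency_block ::
    "nat list \<Rightarrow> nat list pair_pre_digraph \<Rightarrow> nat list \<Rightarrow> nat list \<Rightarrow> complex mat" where
  "adjacency_block Ns G is js = submatrix (adjacency_matrix Ns G)
     (vertex_index Ns ` layer Ns is) (vertex_index Ns ` layer Ns js)"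

lemma vertex_index_append:
  "length v = length Ms \<Longrightarrow>
    vertex_index (Ms @ Ls) (v @ w) = vertex_index Ms v * prod_list Ls + vertex_index Ls w"
proof (induction v Ms rule: list_induct2)
  case Nil
  then show ?case by (simp add: vertex_index_def)
next
  case (Cons i v N Ms)
  then show ?case by (simp add: vertex_index_Cons algebra_simps)
qed

lemma append_in_multi_indices:
  assumes "length v = length Ms"
  shows "v @ w \<in> multi_indices (Ms @ Ls) \<longleftrightarrow> v \<in> multi_indices Ms \<and> w \<in> multi_indices Ls"
  using assms
  by (induction v Ms rule: list_induct2)
    (auto simp: multi_indices_Nil Cons_in_multi_indices)

lemma vertex_index_layer:
  assumes "r \<le> length Ns" and "is \<in> multi_indices (take r Ns)"
  shows "vertex_index Ns ` layer Ns is =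
    {vertex_index (take r Ns) is * prod_list (drop r Ns) ..<
      vertex_index (take r Ns) is * prod_list (drop r Ns) + prod_list (drop r Ns)}"
proof -
  let ?c = "vertex_index (take r Ns) is * prod_list (drop r Ns)"
  have len: "length is = length (take r Ns)"
    using assms by (simp add: multi_indices_def)
  have idx: "vertex_index Ns (is @ u) = ?c + vertex_index (drop r Ns) u" for u
    using vertex_index_append[OF len, of "drop r Ns" u] by simp
  have mem: "is @ u \<in> multi_indices Ns \<longleftrightarrow> u \<in> multi_indices (drop r Ns)" for u
    using append_in_multi_indices[OF len, of u "drop r Ns"] assms by simp
  have "layer Ns is = (\<lambda>u. is @ u) ` multi_indices (drop r Ns)"
  proof (intro subset_antisym subsetI)
    fix v assume v: "v \<in> layer Ns is"
    then have "v = is @ drop (length is) v"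
      by (metis (mono_tags, lifting) append_take_drop_id layer_def mem_Collect_eq)
    then show "v \<in> (\<lambda>u. is @ u) ` multi_indices (drop r Ns)"
      using v mem[of "drop (length is) v"] by (auto simp: layer_def)
  qed (auto simp: layer_def mem)
  then have "vertex_index Ns ` layer Ns is =
      (\<lambda>k. ?c + k) ` vertex_index (drop r Ns) ` multi_indices (drop r Ns)"
    by (simp add: image_image idx)
  also have "vertex_index (drop r Ns) ` multi_indices (drop r Ns) = {0..<prod_list (drop r Ns)}"
    using bij_betw_vertex_index[of "drop r Ns"] by (simp add: bij_betw_def lessThan_atLeast0)
  also have "(\<lambda>k. ?c + k) ` {0..<prod_list (drop r Ns)} = {?c..<?c + prod_list (drop r Ns)}"
    by (simp add: image_add_atLeastLessThan add.commute)
  finally show ?thesis .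
qed

lemma adjacency_block_entry:
  assumes "r \<le> length Ns"
    and "is \<in> multi_indices (take r Ns)" and "js \<in> multi_indices (take r Ns)"
  shows "adjacency_block Ns G is js \<in> carrier_mat (prod_list (drop r Ns)) (prod_list (drop r Ns))"
    and "u \<in> multi_indices (drop r Ns) \<Longrightarrow> v \<in> multi_indices (drop r Ns) \<Longrightarrow>
      adjacency_block Ns G is js $$ (vertex_index (drop r Ns) u, vertex_index (drop r Ns) v) =
        (if (is @ u, js @ v) \<in> parcs G then 1 else 0)"
proof -
  let ?D = "prod_list Ns" and ?d = "prod_list (drop r Ns)"
  let ?I = "\<lambda>is. vertex_index Ns ` layer Ns is"
  have I: "?I ks \<subseteq> {..<?D}" for ks
    using vertex_index_less by (auto simp: layer_def)
  have card: "card {a. a < ?D \<and> a \<in> ?I ks} = ?d" if "ks \<in> multi_indices (take r Ns)" for ks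
  proof -
    have "{a. a < ?D \<and> a \<in> ?I ks} = ?I ks"
      using I by blast
    then show ?thesis
      using vertex_index_layer[OF assms(1) that] by simp
  qed
  show carrier: "adjacency_block Ns G is js \<in> carrier_mat ?d ?d"
    using card assms
    by (intro carrier_matI) (simp_all add: adjacency_block_def adjacency_matrix_def dim_submatrix)
  show "adjacency_block Ns G is js $$ (vertex_index (drop r Ns) u, vertex_index (drop r Ns) v) =
        (if (is @ u, js @ v) \<in> parcs G then 1 else 0)"
    if uv: "u \<in> multi_indices (drop r Ns)" "v \<in> multi_indices (drop r Ns)"
  proof -
    have pick: "pick (?I ks) (vertex_index (drop r Ns) w) = vertex_index Ns (ks @ w) \<and>
        ks @ w \<in> multi_indices Ns"
      if ks: "ks \<in> multi_indices (take r Ns)" and w: "w \<in> multi_indices (drop r Ns)" for ks w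
    proof -
      have len: "length ks = length (take r Ns)"
        using ks by (simp add: multi_indices_def)
      have mem: "ks @ w \<in> multi_indices Ns"
        using append_in_multi_indices[OF len, of w "drop r Ns"] ks w by simp
      then have "vertex_index Ns (ks @ w) \<in> ?I ks"
        by (auto simp: layer_def)
      note 1 = pick_card_in_set[OF this]
      have less: "vertex_index (drop r Ns) w < ?d"
        using w vertex_index_less by blast
      have "{a \<in> ?I ks. a < vertex_index Ns (ks @ w)} =
          {vertex_index (take r Ns) ks * ?d ..<
            vertex_index (take r Ns) ks * ?d + vertex_index (drop r Ns) w}"
        unfolding vertex_index_layer[OF assms(1) ks]
        using vertex_index_append[OF len, of "drop r Ns" w] less by auto
      then show ?thesis
        using 1 mem by simp
    qed
    have less: "vertex_index (drop r Ns) u < ?d" "vertex_index (drop r Ns) v < ?d"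
      using uv vertex_index_less by blast+
    have mem: "is @ u \<in> multi_indices Ns" "js @ v \<in> multi_indices Ns"
      using pick assms uv by blast+
    have "adjacency_block Ns G is js $$ (vertex_index (drop r Ns) u, vertex_index (drop r Ns) v) =
        adjacency_matrix Ns G $$ (vertex_index Ns (is @ u), vertex_index Ns (js @ v))"
      unfolding adjacency_block_def
      using less card assms pick uv
      by (subst submatrix_index) (simp_all add: adjacency_matrix_def)
    then show ?thesis
      using mem vertex_index_less[OF mem(1)] vertex_index_less[OF mem(2)]
      by (simp add: adjacency_matrix_def)
  qed
qed

definition partially_symmetric :: "nat list pair_pre_digraph \<Rightarrow> bool" where
  "partially_symmetric G \<longleftrightarrow>
     (\<forall>i j is js. i \<noteq> j \<longrightarrow> (i # is, j # js) \<in> parcs G \<longrightarrow> (j # is, i # js) \<in> parcs G)"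


subsection \<open>Density matrices and full separability\<close>

definition density_matrix :: "nat \<Rightarrow> complex mat \<Rightarrow> bool" where
  "density_matrix d \<rho> \<longleftrightarrow> \<rho> \<in> carrier_mat d d \<and> mat_adjoint \<rho> = \<rho> \<and>
     (\<forall>x\<in>carrier_vec d. 0 \<le> Re ((\<rho> *\<^sub>v x) \<bullet>c x)) \<and> mat_trace \<rho> = 1"

definition kronecker :: "complex mat \<Rightarrow> complex mat \<Rightarrow> complex mat" where
  "kronecker A B = mat (dim_row A * dim_row B) (dim_col A * dim_col B)
     (\<lambda>(a, b). A $$ (a div dim_row B, b div dim_col B) * B $$ (a mod dim_row B, b mod dim_col B))"

definition tensor_product :: "complex mat list \<Rightarrow> complex mat" where
  "tensor_product As = foldr kronecker As (1\<^sub>m 1)"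

text \<open>
  The basis vector \<open>e\<^bsub>i\<^sub>1\<^esub> \<otimes> \<cdots> \<otimes> e\<^bsub>i\<^sub>n\<^esub>\<close> sits at the position of the vertex
  with multi-index \<open>[i\<^sub>1, \<dots>, i\<^sub>n]\<close>.
\<close>
lemma tensor_product_entry:
  assumes "length As = length Ns" "\<And>k. k < length Ns \<Longrightarrow> As ! k \<in> carrier_mat (Ns ! k) (Ns ! k)"
  shows "tensor_product As \<in> carrier_mat (prod_list Ns) (prod_list Ns)"
    and "u \<in> multi_indices Ns \<Longrightarrow> v \<in> multi_indices Ns \<Longrightarrow>
      tensor_product As $$ (vertex_index Ns u, vertex_index Ns v) =
        (\<Prod>k<length Ns. As ! k $$ (u ! k - 1, v ! k - 1))"
proof -
  have "tensor_product As \<in> carrier_mat (prod_list Ns) (prod_list Ns) \<and>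
    (u \<in> multi_indices Ns \<longrightarrow> v \<in> multi_indices Ns \<longrightarrow>
      tensor_product As $$ (vertex_index Ns u, vertex_index Ns v) =
        (\<Prod>k<length Ns. As ! k $$ (u ! k - 1, v ! k - 1)))"
    using assms
  proof (induction As Ns arbitrary: u v rule: list_induct2)
    case Nil
    then show ?case by (simp add: tensor_product_def vertex_index_def)
  next
    case (Cons A As N Ns)
    have A: "A \<in> carrier_mat N N"
      using Cons.prems[of 0] by simp
    have As: "As ! k \<in> carrier_mat (Ns ! k) (Ns ! k)" if "k < length Ns" for k
      using Cons.prems[of "Suc k"] that by simp
    note IH = Cons.IH[OF As]
    have TP: "tensor_product As \<in> carrier_mat (prod_list Ns) (prod_list Ns)"
      using IH by blast
    have eq: "tensor_product (A # As) = kronecker A (tensor_product As)"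
      by (simp add: tensor_product_def)
    show ?case
    proof (intro conjI impI)
      show "tensor_product (A # As) \<in> carrier_mat (prod_list (N # Ns)) (prod_list (N # Ns))"
        using A TP by (auto simp: eq kronecker_def)
    next
      assume uv: "u \<in> multi_indices (N # Ns)" "v \<in> multi_indices (N # Ns)"
      obtain i u' where u: "u = i # u'" "i \<in> {1..N}" "u' \<in> multi_indices Ns"
        using uv by (blast elim: multi_indices_ConsE)
      obtain j v' where v: "v = j # v'" "j \<in> {1..N}" "v' \<in> multi_indices Ns"
        using uv by (blast elim: multi_indices_ConsE)
      have "vertex_index Ns u' < prod_list Ns" "vertex_index Ns v' < prod_list Ns"
        using u v vertex_index_less by auto
      moreover have "vertex_index (N # Ns) u < N * prod_list Ns"
        "vertex_index (N # Ns) v < N * prod_list Ns"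
        using uv vertex_index_less[of _ "N # Ns"] by auto
      moreover from calculation have "prod_list Ns \<noteq> 0"
        by linarith
      ultimately show "tensor_product (A # As) $$ (vertex_index (N # Ns) u, vertex_index (N # Ns) v) =
          (\<Prod>k<length (N # Ns). (A # As) ! k $$ (u ! k - 1, v ! k - 1))"
        using carrier_matD[OF A] carrier_matD[OF TP] IH[of u' v'] u v
        by (simp add: eq kronecker_def vertex_index_Cons prod.lessThan_Suc_shift del: prod.lessThan_Suc)
    qed
  qed
  then show "tensor_product As \<in> carrier_mat (prod_list Ns) (prod_list Ns)"
    and "u \<in> multi_indices Ns \<Longrightarrow> v \<in> multi_indices Ns \<Longrightarrow>
      tensor_product As $$ (vertex_index Ns u, vertex_index Ns v) =
        (\<Prod>k<length Ns. As ! k $$ (u ! k - 1, v ! k - 1))"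
    by blast+
qed

text \<open>
  The finite sum of matrices is written entrywise because \<open>mat\<close> has no additive monoid
  structure across dimensions.
\<close>
definition fully_separable :: "nat list \<Rightarrow> complex mat \<Rightarrow> bool" where
  "fully_separable Ns \<rho> \<longleftrightarrow> density_matrix (prod_list Ns) \<rho> \<and>
     (\<exists>(m :: nat) (p :: nat \<Rightarrow> real) (\<sigma> :: nat \<Rightarrow> nat \<Rightarrow> complex mat).
        (\<forall>i<m. 0 \<le> p i) \<and> (\<Sum>i<m. p i) = 1 \<and>
        (\<forall>i<m. \<forall>j<length Ns. density_matrix (Ns ! j) (\<sigma> i j)) \<and>
        \<rho> = mat (prod_list Ns) (prod_list Ns) (\<lambda>(a, b).
          \<Sum>i<m. complex_of_real (p i) * tensor_product (map (\<sigma> i) [0..<length Ns]) $$ (a, b)))"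

end

theory Submission
  imports Defs
begin

text \<open>
  All edges join different layers \<open>C\<^bsub>i\<^sub>1\<^esub>\<close>, so they lie in off-diagonal blocks at every level. At
  level \<open>r\<close> the blocks of an edge \<open>uv\<close> and of its reverse are both nonzero, hence equal; this says
  that exchanging the first \<open>r\<close> coordinates of \<open>u\<close> and \<open>v\<close> gives an edge again. Combining such
  exchanges, the edge set is closed under exchanging any set of coordinates. Consequently
  \<open>D + A\<close> is the average over the arcs \<open>uv\<close> of
  \<open>\<Otimes>\<^sub>k (E\<^bsub>u\<^sub>k u\<^sub>k\<^esub> + E\<^bsub>v\<^sub>k v\<^sub>k\<^esub>) + \<Otimes>\<^sub>k (E\<^bsub>u\<^sub>k v\<^sub>k\<^esub> + E\<^bsub>v\<^sub>k u\<^sub>k\<^esub>)\<close>, up to a scalar.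
  The two factors are \<open>P\<^sub>k\<^sup>+ + P\<^sub>k\<^sup>-\<close> and \<open>P\<^sub>k\<^sup>+ - P\<^sub>k\<^sup>-\<close> with \<open>P\<^sub>k\<^sup>\<plusminus>\<close> half of
  \<open>(e\<^bsub>u\<^sub>k\<^esub> \<plusminus> e\<^bsub>v\<^sub>k\<^esub>)(e\<^bsub>u\<^sub>k\<^esub> \<plusminus> e\<^bsub>v\<^sub>k\<^esub>)\<^sup>*\<close>; expanding, only the products with an even number of minus
  signs survive, and with a positive coefficient.
\<close>

subsection \<open>Sums of product kets\<close>

lemma mat_adjoint_eq:
  "\<rho> \<in> carrier_mat d d \<Longrightarrow> mat_adjoint \<rho> = mat d d (\<lambda>(i, j). cnj (\<rho> $$ (j, i)))"
  by (rule eq_matI) (auto simp: mat_adjoint_def mat_of_rows_index)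

text \<open>Real \<open>c\<close> makes the matrix Hermitian, and its quadratic form at
  \<open>x\<close> is the sum of \<open>c l * |z l|^2\<close>, where \<open>z l\<close> is the inner
  product of \<open>\<psi> l\<close> with \<open>x\<close>. Positivity is then termwise.\<close>

lemma density_matrix_rank_one_sum:
  assumes \<rho>: "\<rho> = mat d d (\<lambda>(i, j). \<Sum>l\<in>I. complex_of_real (c l) * (\<psi> l i * cnj (\<psi> l j)))"
    and c: "\<And>l. l \<in> I \<Longrightarrow> 0 \<le> c l" and trace: "mat_trace \<rho> = 1"
  shows "density_matrix d \<rho>"
  unfolding density_matrix_def
proof (intro conjI ballI)
  show carrier: "\<rho> \<in> carrier_mat d d"
    by (simp add: \<rho>)
  show "mat_adjoint \<rho> = \<rho>"
    by (subst mat_adjoint_eq[OF carrier]) (auto simp: \<rho> mult_ac)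
  fix x :: "complex vec" assume x: "x \<in> carrier_vec d"
  define z where "z l = (\<Sum>i<d. \<psi> l i * cnj (x $ i))" for l
  have z: "z l * cnj (z l) = (\<Sum>i<d. \<Sum>j<d. \<psi> l i * cnj (\<psi> l j) * x $ j * cnj (x $ i))" for l
    unfolding z_def cnj_sum sum_product by (simp add: mult_ac)
  have "(\<rho> *\<^sub>v x) \<bullet>c x = (\<Sum>i<d. (\<Sum>j<d. \<rho> $$ (i, j) * x $ j) * cnj (x $ i))"
    using x carrier by (auto simp: scalar_prod_def lessThan_atLeast0 intro!: sum.cong)
  also have "\<dots> = (\<Sum>i<d. \<Sum>j<d. \<Sum>l\<in>I. of_real (c l) * (\<psi> l i * cnj (\<psi> l j) * x $ j * cnj (x $ i)))"
    by (simp add: \<rho> sum_distrib_left sum_distrib_right mult_ac)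
  also have "\<dots> = (\<Sum>l\<in>I. of_real (c l) * (z l * cnj (z l)))"
    unfolding z sum_distrib_left
    by (subst sum.swap, subst (2) sum.swap, subst sum.swap) (intro sum.cong sum.swap refl)
  also have "\<dots> = of_real (\<Sum>l\<in>I. c l * (cmod (z l))\<^sup>2)"
    by (simp flip: complex_norm_square)
  finally show "0 \<le> Re ((\<rho> *\<^sub>v x) \<bullet>c x)"
    using c by (simp add: sum_nonneg)
qed (fact trace)

lemma density_matrix_ket:
  assumes "(\<Sum>i<d. \<psi> i * cnj (\<psi> i)) = 1"
  shows "density_matrix d (mat d d (\<lambda>(i, j). \<psi> i * cnj (\<psi> j)))"
  by (rule density_matrix_rank_one_sum[where I = "{()}" and c = "\<lambda>_. 1" and \<psi> = "\<lambda>_. \<psi>"])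
    (use assms in \<open>simp_all add: mat_trace_def\<close>)

lemma vertex_at_in_multi_indices:
  assumes "a < prod_list Ns"
  shows "vertex_at Ns a \<in> multi_indices Ns" "vertex_index Ns (vertex_at Ns a) = a"
proof -
  obtain v where "v \<in> multi_indices Ns" "a = vertex_index Ns v"
    using bij_betw_vertex_index[of Ns] assms unfolding bij_betw_def by blast
  then show "vertex_at Ns a \<in> multi_indices Ns" "vertex_index Ns (vertex_at Ns a) = a"
    by simp_all
qed

text \<open>Separability criterion used below: a convex combination of projectors onto product kets,
  with any finite index set. Entries are given at multi-indices, so that sums over arcs fit
  directly; \<open>- 1\<close> turns a coordinate, counted from 1, into a matrix position, counted
  from 0.\<close>

lemma fully_separable_product_ket_sum:
  assumes I: "finite I" and p: "\<And>l. l \<in> I \<Longrightarrow> 0 \<le> p l" "(\<Sum>l\<in>I. p l) = 1"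
    and unit: "\<And>l k. l \<in> I \<Longrightarrow> k < length Ns \<Longrightarrow> (\<Sum>i<Ns ! k. \<psi> l k i * cnj (\<psi> l k i)) = 1"
    and \<rho>: "\<rho> \<in> carrier_mat (prod_list Ns) (prod_list Ns)" "mat_trace \<rho> = 1"
    and entry: "\<And>x y. x \<in> multi_indices Ns \<Longrightarrow> y \<in> multi_indices Ns \<Longrightarrow>
      \<rho> $$ (vertex_index Ns x, vertex_index Ns y) = (\<Sum>l\<in>I. complex_of_real (p l) *
        (\<Prod>k<length Ns. \<psi> l k (x ! k - 1) * cnj (\<psi> l k (y ! k - 1))))"
  shows "fully_separable Ns \<rho>"
proof -
  let ?D = "prod_list Ns" and ?at = "vertex_at Ns"
  have \<rho>_eq: "\<rho> $$ (a, b) = (\<Sum>l\<in>I. complex_of_real (p l) *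
      (\<Prod>k<length Ns. \<psi> l k (?at a ! k - 1) * cnj (\<psi> l k (?at b ! k - 1))))"
    if "a < ?D" "b < ?D" for a b
    using entry[of "?at a" "?at b"] that by (simp add: vertex_at_in_multi_indices)
  have dens: "density_matrix ?D \<rho>"
  proof (rule density_matrix_rank_one_sum[where I = I and c = p
        and \<psi> = "\<lambda>l a. \<Prod>k<length Ns. \<psi> l k (?at a ! k - 1)"])
    show "\<rho> = mat ?D ?D (\<lambda>(i, j). \<Sum>l\<in>I. complex_of_real (p l) *
        ((\<Prod>k<length Ns. \<psi> l k (?at i ! k - 1)) * cnj (\<Prod>k<length Ns. \<psi> l k (?at j ! k - 1))))"
      using \<rho> by (intro eq_matI) (auto simp: \<rho>_eq prod.distrib)
  qed (use p \<rho> in auto)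
  obtain e where e: "bij_betw e {..<card I} I"
    using ex_bij_betw_nat_finite[OF I] by (auto simp: lessThan_atLeast0)
  define \<sigma> where "\<sigma> l k = mat (Ns ! k) (Ns ! k) (\<lambda>(i, j). \<psi> l k i * cnj (\<psi> l k j))" for l k
  have \<sigma>: "tensor_product (map (\<sigma> l) [0..<length Ns]) $$ (a, b) =
      (\<Prod>k<length Ns. \<psi> l k (?at a ! k - 1) * cnj (\<psi> l k (?at b ! k - 1)))"
    if ab: "a < ?D" "b < ?D" for a b l
  proof -
    have less: "?at c ! k - 1 < Ns ! k" if "c < ?D" "k < length Ns" for c k
      using vertex_at_in_multi_indices(1)[OF that(1)] that(2)
      by (fastforce simp: multi_indices_def)
    have "tensor_product (map (\<sigma> l) [0..<length Ns]) $$ (vertex_index Ns (?at a), vertex_index Ns (?at b)) =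
      (\<Prod>k<length Ns. map (\<sigma> l) [0..<length Ns] ! k $$ (?at a ! k - 1, ?at b ! k - 1))"
      using ab by (intro tensor_product_entry) (auto simp: \<sigma>_def vertex_at_in_multi_indices)
    also have "\<dots> = (\<Prod>k<length Ns. \<psi> l k (?at a ! k - 1) * cnj (\<psi> l k (?at b ! k - 1)))"
      using ab less by (intro prod.cong) (auto simp: \<sigma>_def simp del: One_nat_def)
    finally show ?thesis
      using ab by (simp add: vertex_at_in_multi_indices)
  qed
  have e_in: "e i \<in> I" if "i < card I" for i
    using e that by (auto simp: bij_betw_def)
  have "\<rho> = mat ?D ?D (\<lambda>(a, b). \<Sum>i<card I. complex_of_real (p (e i)) *
      tensor_product (map (\<sigma> (e i)) [0..<length Ns]) $$ (a, b))"
    using \<rho> by (intro eq_matI) (auto simp: \<rho>_eq \<sigma> sum.reindex_bij_betw[OF e, symmetric])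
  moreover have "density_matrix (Ns ! j) (\<sigma> (e i) j)" if "i < card I" "j < length Ns" for i j
    unfolding \<sigma>_def using that unit e_in by (intro density_matrix_ket) auto
  ultimately show ?thesis
    unfolding fully_separable_def using dens p e_in sum.reindex_bij_betw[OF e, of p]
    by (intro conjI exI[of _ "card I"] exI[of _ "\<lambda>i. p (e i)"] exI[of _ "\<lambda>i. \<sigma> (e i)"]) auto
qed

subsection \<open>Expanding products over subsets\<close>

lemma prod_of_bool: "finite A \<Longrightarrow>
    (\<Prod>i\<in>A. of_bool (P i)) = (of_bool (\<forall>i\<in>A. P i) :: 'a :: comm_semiring_1)"
  by (induction A rule: finite_induct) auto

lemma prod_add_subsets:
  fixes f g :: "'i \<Rightarrow> 'a :: comm_semiring_1"
  assumes "finite A"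
  shows "(\<Prod>i\<in>A. f i + g i) = (\<Sum>S\<in>Pow A. \<Prod>i\<in>A. if i \<in> S then g i else f i)"
  unfolding add.commute[of "f _"] prod_add[OF assms]
proof (rule sum.cong[OF refl])
  fix S assume "S \<in> Pow A"
  then have "A \<inter> S = S" "A \<inter> - S = A - S" by auto
  then show "prod g S * prod f (A - S) = (\<Prod>i\<in>A. if i \<in> S then g i else f i)"
    using assms by (simp add: prod.If_cases)
qed

text \<open>The factor \<open>1 + (-1) ^ card S\<close> doubles even subsets and removes odd ones.
  Expanding the product of sums gives every subset with sign +, and the product of differences gives
  it with sign \<open>(-1) ^ card S\<close>.\<close>

lemma sum_even_subsets:
  fixes h :: "'i \<Rightarrow> bool \<Rightarrow> 'a :: comm_ring_1"
  assumes "finite A"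
  shows "(\<Sum>S\<in>Pow A. (1 + (-1) ^ card S) * (\<Prod>i\<in>A. h i (i \<in> S))) =
    (\<Prod>i\<in>A. h i False + h i True) + (\<Prod>i\<in>A. h i False - h i True)"
proof -
  have sign: "(\<Prod>i\<in>A. if i \<in> S then - h i True else h i False) = (-1) ^ card S * (\<Prod>i\<in>A. h i (i \<in> S))"
    if "S \<in> Pow A" for S
  proof -
    have "(\<Prod>i\<in>A. if i \<in> S then - h i True else h i False) =
        (\<Prod>i\<in>A. (if i \<in> S then -1 else 1) * h i (i \<in> S))"
      by (intro prod.cong) auto
    moreover have "A \<inter> S = S"
      using that by auto
    ultimately show ?thesis
      using assms by (simp add: prod.distrib prod.If_cases)
  qed
  have "(\<Prod>i\<in>A. h i False + h i True) = (\<Sum>S\<in>Pow A. \<Prod>i\<in>A. h i (i \<in> S))"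
    unfolding prod_add_subsets[OF assms] by (intro sum.cong prod.cong) auto
  moreover have "(\<Prod>i\<in>A. h i False - h i True) = (\<Sum>S\<in>Pow A. (-1) ^ card S * (\<Prod>i\<in>A. h i (i \<in> S)))"
    using prod_add_subsets[OF assms, of "\<lambda>i. h i False" "\<lambda>i. - h i True"] sign by simp
  ultimately show ?thesis
    by (simp add: distrib_right sum.distrib)
qed

subsection \<open>Exchanging coordinates\<close>

definition mix_coords :: "nat set \<Rightarrow> 'a list \<Rightarrow> 'a list \<Rightarrow> 'a list" where
  "mix_coords T u v = map (\<lambda>k. if k \<in> T then v ! k else u ! k) [0..<length u]"

lemma length_mix_coords [simp]: "length (mix_coords T u v) = length u"
  by (simp add: mix_coords_def)

lemma nth_mix_coords [simp]:
  "k < length u \<Longrightarrow> mix_coords T u v ! k = (if k \<in> T then v ! k else u ! k)"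
  by (simp add: mix_coords_def)

text \<open>Exchanges compose by symmetric difference. With \<open>S = T\<close> this makes each
  exchange an involution; with two prefixes it isolates one coordinate.\<close>

lemma mix_coords_symdiff:
  assumes "length u = length v"
  shows "mix_coords S (mix_coords T u v) (mix_coords T v u) = mix_coords ((S - T) \<union> (T - S)) u v"
  using assms by (intro nth_equalityI) auto

lemma mix_coords_empty [simp]: "mix_coords {} u v = u"
  by (intro nth_equalityI) auto

text \<open>Expanding the product gives one term for each set \<open>T\<close> of exchanged
  coordinates. Each exchange is an involution of \<open>E\<close>, so it only permutes the outer
  sum, and all \<open>2 ^ n\<close> sets contribute equally.\<close>

lemma sum_prod_symmetrize:
  fixes g :: "nat \<Rightarrow> 'a \<Rightarrow> 'a \<Rightarrow> 'b :: comm_ring_1"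
  assumes len: "\<And>u v. (u, v) \<in> E \<Longrightarrow> length u = n \<and> length v = n"
    and closed: "\<And>u v T. (u, v) \<in> E \<Longrightarrow> (mix_coords T u v, mix_coords T v u) \<in> E"
  shows "(\<Sum>(u, v)\<in>E. \<Prod>k<n. g k (u ! k) (v ! k) + g k (v ! k) (u ! k)) =
    2 ^ n * (\<Sum>(u, v)\<in>E. \<Prod>k<n. g k (u ! k) (v ! k))"
proof -
  let ?h = "\<lambda>u v. \<Prod>k<n. g k (u ! k) (v ! k)"
  let ?swap = "\<lambda>T (u, v). (mix_coords T u v, mix_coords T v u)"
  have "(\<Sum>(u, v)\<in>E. \<Prod>k<n. g k (u ! k) (v ! k) + g k (v ! k) (u ! k)) =
      (\<Sum>(u, v)\<in>E. \<Sum>T\<in>Pow {..<n}. ?h (mix_coords T u v) (mix_coords T v u))"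
    by (subst prod_add_subsets) (auto intro!: sum.cong prod.cong dest: len)
  also have "\<dots> = (\<Sum>T\<in>Pow {..<n}. \<Sum>(u, v)\<in>E. ?h (mix_coords T u v) (mix_coords T v u))"
    by (subst sum.swap) (simp add: case_prod_unfold)
  also have "\<dots> = (\<Sum>T\<in>Pow {..<n}. \<Sum>(u, v)\<in>E. ?h u v)"
  proof (rule sum.cong[OF refl])
    fix T
    show "(\<Sum>(u, v)\<in>E. ?h (mix_coords T u v) (mix_coords T v u)) = (\<Sum>(u, v)\<in>E. ?h u v)"
      by (rule sum.reindex_bij_witness[where i = "?swap T" and j = "?swap T"])
        (auto simp: closed mix_coords_symdiff dest: len)
  qed
  finally show ?thesis
    by (simp add: card_Pow)
qed

subsection \<open>Pair kets\<close>

text \<open>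
  \<open>pair_weight\<close> is half the squared norm of \<open>e\<^sub>a \<plusminus> e\<^sub>b\<close>. For \<open>a = b\<close>
  the vector \<open>e\<^sub>a - e\<^sub>b\<close> vanishes, so any unit vector may serve as its ket.
\<close>
definition pair_weight :: "nat \<Rightarrow> nat \<Rightarrow> bool \<Rightarrow> real" where
  "pair_weight a b s = (if a = b then (if s then 0 else 2) else 1)"

text \<open>The normalised \<open>e_a + e_b\<close>, or \<open>e_a - e_b\<close> when
  \<open>s\<close> is true. Labels \<open>a\<close>, \<open>b\<close> start at 1 and positions
  \<open>i\<close> at 0, hence \<open>Suc i\<close>.\<close>

definition pair_ket :: "nat \<Rightarrow> nat \<Rightarrow> bool \<Rightarrow> nat \<Rightarrow> complex" where
  "pair_ket a b s i = (if a = b then of_bool (Suc i = a)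
     else (of_bool (Suc i = a) + (if s then -1 else 1) * of_bool (Suc i = b)) / complex_of_real (sqrt 2))"

lemma pair_ket_outer:
  "pair_ket a b s i * cnj (pair_ket a b s j) = (if a = b then of_bool (Suc i = a \<and> Suc j = a)
     else (of_bool (Suc i = a) + (if s then -1 else 1) * of_bool (Suc i = b)) *
       (of_bool (Suc j = a) + (if s then -1 else 1) * of_bool (Suc j = b)) / 2)"
proof -
  have "complex_of_real (sqrt 2) * complex_of_real (sqrt 2) = 2"
    by (simp flip: of_real_mult)
  then show ?thesis
    by (auto simp: pair_ket_def)
qed

lemma pair_ket_unit:
  assumes "a \<in> {1..N}" "b \<in> {1..N}"
  shows "(\<Sum>i<N. pair_ket a b s i * cnj (pair_ket a b s i)) = 1"
proof -
  have eq: "pair_ket a b s i * cnj (pair_ket a b s i) =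
      (of_bool (i = a - 1) + of_bool (i = b - 1)) / 2" for i
    using assms unfolding pair_ket_outer by (auto split: if_splits)
  have one: "(\<Sum>i<N. of_bool (i = c - 1) :: complex) = 1" if "c \<in> {1..N}" for c
  proof -
    have "c - 1 < N"
      using that unfolding atLeastAtMost_iff by linarith
    then show ?thesis
      by (simp add: of_bool_def sum.delta)
  qed
  show ?thesis
    unfolding eq sum_divide_distrib[symmetric] sum.distrib using assms by (simp only: one) simp
qed

text \<open>In matrix form, the two signs add up to \<open>E_aa + E_bb\<close> and differ by
  \<open>E_ab + E_ba\<close>. For \<open>a = b\<close> the weights 2 and 0 make both equal to
  \<open>2 E_aa\<close>.\<close>

lemma pair_ket_sum:
  fixes a b i j :: nat
  defines "K \<equiv> \<lambda>s. complex_of_real (pair_weight a b s) * (pair_ket a b s i * cnj (pair_ket a b s j))"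
  shows "K False + K True = of_bool (a = Suc i \<and> a = Suc j) + of_bool (b = Suc i \<and> b = Suc j)"
    and "K False - K True = of_bool (a = Suc i \<and> b = Suc j) + of_bool (b = Suc i \<and> a = Suc j)"
  unfolding K_def pair_ket_outer pair_weight_def by (auto simp: field_simps)

subsection \<open>Graphs closed under exchanging coordinates\<close>

text \<open>Degree and adjacency are both written as sums over arcs, the shape that
  \<open>sum_prod_symmetrize\<close> handles. The first sum counts the arcs leaving \<open>x\<close>
  when \<open>x = y\<close>.\<close>

lemma signless_laplacian_entry:
  assumes "x \<in> multi_indices Ns" "y \<in> multi_indices Ns" "finite (parcs G)"
  shows "signless_laplacian Ns G $$ (vertex_index Ns x, vertex_index Ns y) =
    (\<Sum>(u, v)\<in>parcs G. of_bool (u = x \<and> u = y)) + (\<Sum>(u, v)\<in>parcs G. of_bool (u = x \<and> v = y))"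
proof -
  have "inj_on (vertex_index Ns) (multi_indices Ns)"
    using bij_betw_vertex_index by (simp add: bij_betw_def)
  then have inj: "vertex_index Ns x = vertex_index Ns y \<longleftrightarrow> x = y"
    using assms by (auto dest: inj_onD)
  have deg: "(\<Sum>(u, v)\<in>parcs G. of_bool (u = x \<and> u = y)) =
      (if x = y then of_nat (out_degree (with_proj G) x) else (0 :: complex))"
    using assms(3)
    by (auto simp: out_degree_def out_arcs_def case_prod_unfold of_bool_def
        sum.If_cases Int_def conj_commute intro!: sum.neutral)
  have adj: "(\<Sum>(u, v)\<in>parcs G. of_bool (u = x \<and> v = y)) = (of_bool ((x, y) \<in> parcs G) :: complex)"
  proof -
    have "(\<Sum>(u, v)\<in>parcs G. of_bool (u = x \<and> v = y) :: complex) =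
        (\<Sum>e\<in>parcs G. if e = (x, y) then 1 else 0)"
      by (intro sum.cong) auto
    then show ?thesis
      using assms(3) by simp
  qed
  show ?thesis
    unfolding deg adj
    using assms vertex_index_less[OF assms(1)] vertex_index_less[OF assms(2)] inj
    by (simp add: signless_laplacian_def degree_matrix_def adjacency_matrix_def)
qed

lemma trace_signless_laplacian:
  assumes G: "pair_graph G" and V: "pverts G = multi_indices Ns"
  shows "mat_trace (signless_laplacian Ns G) = of_nat (card (parcs G))"
proof -
  interpret pair_graph G by (rule G)
  have fin: "finite (multi_indices Ns)"
    using pair_finite_verts V by simp
  have "mat_trace (signless_laplacian Ns G) =
      (\<Sum>a<prod_list Ns. signless_laplacian Ns G $$ (a, a))"
    by (simp add: mat_trace_def signless_laplacian_def degree_matrix_def adjacency_matrix_def)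
  also have "\<dots> = (\<Sum>x\<in>multi_indices Ns.
      signless_laplacian Ns G $$ (vertex_index Ns x, vertex_index Ns x))"
    by (rule sum.reindex_bij_betw[OF bij_betw_vertex_index, symmetric])
  also have "\<dots> = (\<Sum>x\<in>multi_indices Ns. \<Sum>(u, v)\<in>parcs G. of_bool (u = x))"
  proof (rule sum.cong[OF refl])
    fix x assume x: "x \<in> multi_indices Ns"
    \<comment> \<open>Without loops only degrees reach the diagonal; summing them counts each arc
      once, at its source.\<close>
    have "(\<Sum>(u, v)\<in>parcs G. of_bool (u = x \<and> v = x)) = (0 :: complex)"
      using pair_no_loops[of "(x, x)"] by (intro sum.neutral) auto
    then show "signless_laplacian Ns G $$ (vertex_index Ns x, vertex_index Ns x) =
        (\<Sum>(u, v)\<in>parcs G. of_bool (u = x))"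
      using signless_laplacian_entry[OF x x pair_finite_arcs] by simp
  qed
  also have "\<dots> = (\<Sum>(u, v)\<in>parcs G. \<Sum>x\<in>multi_indices Ns. of_bool (u = x))"
    by (subst sum.swap) (simp add: case_prod_unfold)
  also have "\<dots> = (\<Sum>(u, v)\<in>parcs G. 1)"
    using fin in_arcsD1 V by (intro sum.cong) (auto simp: of_bool_def sum.delta')
  finally show ?thesis
    by (simp add: case_prod_unfold)
qed

lemma fully_separable_rho_q_if_closed:
  assumes G: "pair_graph G" and V: "pverts G = multi_indices Ns" and ne: "parcs G \<noteq> {}"
    and closed: "\<And>u v T. (u, v) \<in> parcs G \<Longrightarrow> (mix_coords T u v, mix_coords T v u) \<in> parcs G"
  shows "fully_separable Ns (rho_q Ns G)"
proof -
  interpret pair_graph G by (rule G)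
  let ?n = "length Ns" and ?E = "parcs G" and ?P = "Pow {..<length Ns}"
  let ?Q = "signless_laplacian Ns G"
  \<comment> \<open>The factor \<open>2 ^ ?n\<close> comes from symmetrizing over exchanges, and
    \<open>card ?E\<close> is the trace. The pure states are indexed by an arc and a set
    \<open>S\<close> of coordinates that carry a minus sign.\<close>
  define M :: real where "M = 2 ^ ?n * card ?E"
  define W where "W = (\<lambda>(u, v) S. (1 + (-1) ^ card S) *
    (\<Prod>k<?n. pair_weight (u ! k) (v ! k) (k \<in> S)))"
  let ?p = "\<lambda>(e, S). W e S / M"
  let ?\<psi> = "\<lambda>((u, v), S) k. pair_ket (u ! k) (v ! k) (k \<in> S)"
  have E: "finite ?E" by (rule pair_finite_arcs)
  have pos: "card ?E > 0" using E ne by (simp add: card_gt_0_iff)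
  then have M: "M > 0" by (simp add: M_def)
  have V1: "u \<in> multi_indices Ns" "v \<in> multi_indices Ns" "u \<noteq> v" if "(u, v) \<in> ?E" for u v
    using that in_arcsD1 in_arcsD2 V pair_no_loops[OF that] by auto
  then have len: "length u = ?n \<and> length v = ?n" if "(u, v) \<in> ?E" for u v
    using that by (simp add: multi_indices_def)
  have range: "w ! k \<in> {1..Ns ! k}" if "w \<in> multi_indices Ns" "k < ?n" for w k
    using that by (simp add: multi_indices_def)
  have trace: "mat_trace ?Q = of_nat (card ?E)"
    by (rule trace_signless_laplacian[OF G V])
  have dim: "?Q \<in> carrier_mat (prod_list Ns) (prod_list Ns)"
    by (simp add: signless_laplacian_def degree_matrix_def adjacency_matrix_def)
  show ?thesis
  proof (rule fully_separable_product_ket_sum[where I = "?E \<times> ?P" and p = ?p and \<psi> = ?\<psi>])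
    show "finite (?E \<times> ?P)" using E by simp
    have "(-1 :: real) ^ m \<ge> -1" for m :: nat
      by (cases "even m") simp_all
    then have "1 + (-1 :: real) ^ m \<ge> 0" for m :: nat
      by (smt (verit))
    then show "0 \<le> ?p l" if "l \<in> ?E \<times> ?P" for l
      using M by (auto simp: W_def pair_weight_def split: prod.split
          intro!: divide_nonneg_pos mult_nonneg_nonneg prod_nonneg)
    have "(\<Sum>S\<in>?P. W e S) = 2 ^ ?n" if "e \<in> ?E" for e
    proof -
      obtain u v where e: "e = (u, v)" by fastforce
      have "u \<noteq> v" "length u = ?n" "length v = ?n"
        using that V1 len e by auto
      then obtain k where k: "k < ?n" "u ! k \<noteq> v ! k"
        by (metis nth_equalityI)
      \<comment> \<open>At a coordinate where \<open>u\<close> and \<open>v\<close> differ both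
        signs have weight 1, so the signed product vanishes and each arc has total weight
        \<open>2 ^ ?n\<close>.\<close>
      have zero: "(\<Prod>k<?n. pair_weight (u ! k) (v ! k) False - pair_weight (u ! k) (v ! k) True) = 0"
        using k by (intro prod_zero) (auto simp: pair_weight_def)
      have two: "pair_weight a b False + pair_weight a b True = 2" for a b
        by (simp add: pair_weight_def)
      show ?thesis
        unfolding W_def e prod.case by (subst sum_even_subsets) (simp_all add: zero two)
    qed
    then show "sum ?p (?E \<times> ?P) = 1"
      using pos ne by (simp add: sum.cartesian_product[symmetric] sum_divide_distrib[symmetric] M_def)
    show "(\<Sum>i<Ns ! k. ?\<psi> l k i * cnj (?\<psi> l k i)) = 1" if "l \<in> ?E \<times> ?P" "k < ?n" for l k
      using that V1 range by (auto intro!: pair_ket_unit simp del: atLeastAtMost_iff)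
    show "rho_q Ns G \<in> carrier_mat (prod_list Ns) (prod_list Ns)"
      using dim by (simp add: rho_q_def)
    have "mat_trace (rho_q Ns G) = mat_trace ?Q / mat_trace ?Q"
      unfolding rho_q_def mat_trace_def using dim by (simp flip: sum_divide_distrib)
    then show "mat_trace (rho_q Ns G) = 1"
      using trace pos ne by simp
    fix x y assume x: "x \<in> multi_indices Ns" and y: "y \<in> multi_indices Ns"
    have Suc: "Suc (w ! k - 1) = w ! k" if "w \<in> multi_indices Ns" "k < ?n" for w k
      using range[OF that] by simp
    have eq_iff: "w = z \<longleftrightarrow> (\<forall>k\<in>{..<?n}. w ! k = z ! k)"
      if "w \<in> multi_indices Ns" "z \<in> multi_indices Ns" for w z
      using that by (auto simp: multi_indices_def intro: nth_equalityI)
    \<comment> \<open>The weighted entry of the \<open>k\<close>-th tensor factor at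
      \<open>(x, y)\<close>. Its sums over the two signs yield the degree part
      (\<open>diag\<close>), its differences the adjacency part (\<open>cross\<close>).\<close>
    define K where "K = (\<lambda>(u, v) k s. complex_of_real (pair_weight (u ! k) (v ! k) s) *
      (pair_ket (u ! k) (v ! k) s (x ! k - 1) * cnj (pair_ket (u ! k) (v ! k) s (y ! k - 1))))"
    let ?b = "of_bool :: bool \<Rightarrow> complex"
    have diag: "(\<Sum>(u, v)\<in>?E. \<Prod>k<?n. K (u, v) k False + K (u, v) k True) =
        2 ^ ?n * (\<Sum>(u, v)\<in>?E. ?b (u = x \<and> u = y))"
    proof -
      have "(\<Sum>(u, v)\<in>?E. \<Prod>k<?n. K (u, v) k False + K (u, v) k True) =
        (\<Sum>(u, v)\<in>?E. \<Prod>k<?n. ?b (u ! k = x ! k \<and> u ! k = y ! k) + ?b (v ! k = x ! k \<and> v ! k = y ! k))"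
        unfolding K_def prod.case pair_ket_sum using x y
        by (intro sum.cong prod.cong) (auto simp: Suc simp del: One_nat_def)
      also have "\<dots> = 2 ^ ?n * (\<Sum>(u, v)\<in>?E. \<Prod>k<?n. ?b (u ! k = x ! k \<and> u ! k = y ! k))"
        by (rule sum_prod_symmetrize[OF len closed])
      also have "(\<Sum>(u, v)\<in>?E. \<Prod>k<?n. ?b (u ! k = x ! k \<and> u ! k = y ! k)) =
          (\<Sum>(u, v)\<in>?E. ?b (u = x \<and> u = y))"
        using x y V1(1,2)
        by (intro sum.cong refl) (auto simp: prod_of_bool eq_iff ball_conj_distrib simp del: of_bool_conj)
      finally show ?thesis .
    qed
    have cross: "(\<Sum>(u, v)\<in>?E. \<Prod>k<?n. K (u, v) k False - K (u, v) k True) =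
        2 ^ ?n * (\<Sum>(u, v)\<in>?E. ?b (u = x \<and> v = y))"
    proof -
      have "(\<Sum>(u, v)\<in>?E. \<Prod>k<?n. K (u, v) k False - K (u, v) k True) =
        (\<Sum>(u, v)\<in>?E. \<Prod>k<?n. ?b (u ! k = x ! k \<and> v ! k = y ! k) + ?b (v ! k = x ! k \<and> u ! k = y ! k))"
        unfolding K_def prod.case pair_ket_sum using x y
        by (intro sum.cong prod.cong) (auto simp: Suc simp del: One_nat_def)
      also have "\<dots> = 2 ^ ?n * (\<Sum>(u, v)\<in>?E. \<Prod>k<?n. ?b (u ! k = x ! k \<and> v ! k = y ! k))"
        by (rule sum_prod_symmetrize[OF len closed])
      also have "(\<Sum>(u, v)\<in>?E. \<Prod>k<?n. ?b (u ! k = x ! k \<and> v ! k = y ! k)) =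
          (\<Sum>(u, v)\<in>?E. ?b (u = x \<and> v = y))"
        using x y V1(1,2)
        by (intro sum.cong refl) (auto simp: prod_of_bool eq_iff ball_conj_distrib simp del: of_bool_conj)
      finally show ?thesis .
    qed
    have term_eq: "complex_of_real (W e S / M) * (\<Prod>k<?n. ?\<psi> (e, S) k (x ! k - 1) *
        cnj (?\<psi> (e, S) k (y ! k - 1))) = (1 + (-1) ^ card S) * (\<Prod>k<?n. K e k (k \<in> S)) / M"
      for e S
      by (cases e) (simp add: W_def K_def prod.distrib)
    have "(\<Sum>l\<in>?E \<times> ?P. complex_of_real (?p l) *
        (\<Prod>k<?n. ?\<psi> l k (x ! k - 1) * cnj (?\<psi> l k (y ! k - 1)))) =
        (\<Sum>e\<in>?E. \<Sum>S\<in>?P. (1 + (-1) ^ card S) * (\<Prod>k<?n. K e k (k \<in> S)) / M)"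
      unfolding sum.cartesian_product by (intro sum.cong refl) (use term_eq in auto)
    also have "\<dots> = (\<Sum>e\<in>?E. (\<Prod>k<?n. K e k False + K e k True) + (\<Prod>k<?n. K e k False - K e k True)) / M"
      unfolding sum_divide_distrib[symmetric] by (subst sum_even_subsets) simp_all
    also have "\<dots> = (2 ^ ?n * ?Q $$ (vertex_index Ns x, vertex_index Ns y)) / M"
      using diag cross
      by (simp add: sum.distrib signless_laplacian_entry[OF x y E] case_prod_unfold distrib_left)
    also have "\<dots> = rho_q Ns G $$ (vertex_index Ns x, vertex_index Ns y)"
      using dim vertex_index_less[OF x] vertex_index_less[OF y]
      by (simp add: rho_q_def trace M_def)
    finally show "rho_q Ns G $$ (vertex_index Ns x, vertex_index Ns y) =
      (\<Sum>l\<in>?E \<times> ?P. complex_of_real (?p l) *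
        (\<Prod>k<?n. ?\<psi> l k (x ! k - 1) * cnj (?\<psi> l k (y ! k - 1))))" ..
  qed
qed

text \<open>Exchanging the prefixes of lengths \<open>k\<close> and \<open>Suc k\<close> in turn
  exchanges coordinate \<open>k\<close> alone; any finite set is then built one coordinate at a
  time.\<close>

lemma mix_coords_closed_if_prefix_closed:
  assumes E: "(u, v) \<in> E" "\<And>u v. (u, v) \<in> E \<Longrightarrow> length u = n \<and> length v = n"
    and prefix: "\<And>u v r. (u, v) \<in> E \<Longrightarrow> r \<le> n \<Longrightarrow>
      (mix_coords {..<r} u v, mix_coords {..<r} v u) \<in> E"
  shows "(mix_coords T u v, mix_coords T v u) \<in> E"
proof -
  have single: "(mix_coords {k} u v, mix_coords {k} v u) \<in> E" if "(u, v) \<in> E" "k < n" for u v k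
  proof -
    have "({..<Suc k} - {..<k}) \<union> ({..<k} - {..<Suc k}) = {k}" by auto
    then show ?thesis
      using prefix[OF prefix[OF that(1), of k], of "Suc k"] that E(2)[OF that(1)]
      by (simp add: mix_coords_symdiff)
  qed
  have "(mix_coords S u v, mix_coords S v u) \<in> E" if "finite S" "S \<subseteq> {..<n}" for S
    using that
  proof (induction S rule: finite_induct)
    case empty
    then show ?case using E by simp
  next
    case (insert k S)
    have "({k} - S) \<union> (S - {k}) = insert k S" using insert.hyps by auto
    then show ?case
      using single[of "mix_coords S u v" "mix_coords S v u" k] insert E(2)[OF E(1)]
      by (simp add: mix_coords_symdiff)
  qed
  \<comment> \<open>An arbitrary \<open>T\<close> may be infinite, but positions from
    \<open>n\<close> on do not exist in lists of length \<open>n\<close>.\<close>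
  moreover have "mix_coords (T \<inter> {..<n}) u v = mix_coords T u v"
    "mix_coords (T \<inter> {..<n}) v u = mix_coords T v u"
    using E(2)[OF E(1)] by (auto intro!: nth_equalityI)
  ultimately show ?thesis
    using inf_le2 by (metis finite_Int finite_lessThan)
qed

lemma mix_coords_prefix:
  assumes "length u = length v" "r \<le> length u"
  shows "mix_coords {..<r} u v = take r v @ drop r u"
  using assms by (intro nth_equalityI) (auto simp: nth_append)

theorem theorem4:
  fixes n :: nat and Ns :: "nat list" and G :: "nat list pair_pre_digraph"
  assumes "2 \<le> n" and "length Ns = n" and "\<forall>N\<in>set Ns. 1 \<le> N"
    and "pair_graph G" and "pverts G = multi_indices Ns" and "parcs G \<noteq> {}"
    and "partially_symmetric G"
    and "\<forall>i1\<in>{1..Ns ! 0}. \<forall>u\<in>layer Ns [i1]. \<forall>v\<in>layer Ns [i1]. (u, v) \<notin> parcs G"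
    and "\<forall>r\<in>{1..n - 1}. \<forall>is\<in>multi_indices (take r Ns). \<forall>js\<in>multi_indices (take r Ns).
      \<forall>ks\<in>multi_indices (take r Ns). \<forall>ls\<in>multi_indices (take r Ns).
        is \<noteq> js \<longrightarrow> ks \<noteq> ls \<longrightarrow>
        adjacency_block Ns G is js \<noteq> 0\<^sub>m (prod_list (drop r Ns)) (prod_list (drop r Ns)) \<longrightarrow>
        adjacency_block Ns G ks ls \<noteq> 0\<^sub>m (prod_list (drop r Ns)) (prod_list (drop r Ns)) \<longrightarrow>
        adjacency_block Ns G is js = adjacency_block Ns G ks ls"
    and "\<forall>i1\<in>{1..Ns ! 0}. \<forall>u\<in>layer Ns [i1]. \<forall>v\<in>layer Ns [i1].
      out_degree (with_proj G) u = out_degree (with_proj G) v"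
  shows "fully_separable Ns (rho_q Ns G)"
proof -
  interpret pair_graph G by fact
  have V: "u \<in> multi_indices Ns" "v \<in> multi_indices Ns" if "(u, v) \<in> parcs G" for u v
    using that in_arcsD1 in_arcsD2 assms(5) by auto
  have len: "length u = n \<and> length v = n" if "(u, v) \<in> parcs G" for u v
    using V[OF that] assms(2) by (simp add: multi_indices_def)
  have sym: "(v, u) \<in> parcs G" if "(u, v) \<in> parcs G" for u v
    using pair_sym_arcs that by (simp add: symmetric_def symD)
  have prefix: "(take r v @ drop r u, take r u @ drop r v) \<in> parcs G"
    if uv: "(u, v) \<in> parcs G" and r: "1 \<le> r" "r \<le> n - 1" for u v r
  proof -
    let ?d = "prod_list (drop r Ns)"
    have rl: "r \<le> length Ns" using r assms(2) by simp
    have tk: "take r w \<in> multi_indices (take r Ns)" "drop r w \<in> multi_indices (drop r Ns)"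
      if "w \<in> multi_indices Ns" for w
      using append_in_multi_indices[of "take r w" "take r Ns" "drop r w" "drop r Ns"] that
      by (auto simp: multi_indices_def)
    note tkuv = tk[OF V(1)[OF uv]] tk[OF V(2)[OF uv]]
    \<comment> \<open>Equal prefixes of positive length would put both ends into one layer at level
      1, against condition (1).\<close>
    have neq: "take r u \<noteq> take r v"
    proof
      assume "take r u = take r v"
      then have "take 1 u = take 1 v"
        using r by (metis min.absorb1 take_take)
      moreover obtain i w j z where u: "u = i # w" and "v = j # z"
        using len[OF uv] assms(1) by (cases u; cases v) auto
      ultimately have "u \<in> layer Ns [i]" "v \<in> layer Ns [i]"
        using V[OF uv] by (auto simp: layer_def)
      moreover have "u ! 0 \<in> {1..Ns ! 0}"
        using V(1)[OF uv] assms(1,2) by (simp add: multi_indices_def)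
      ultimately show False
        using assms(8) uv u by auto
    qed
    have block: "adjacency_block Ns G (take r x) (take r y) $$
        (vertex_index (drop r Ns) w, vertex_index (drop r Ns) z) =
        (if (take r x @ w, take r y @ z) \<in> parcs G then 1 else 0)"
      if "x \<in> multi_indices Ns" "y \<in> multi_indices Ns"
        "w \<in> multi_indices (drop r Ns)" "z \<in> multi_indices (drop r Ns)" for x y w z
      using adjacency_block_entry(2)[OF rl tk(1)[OF that(1)] tk(1)[OF that(2)] that(3,4)] .
    have nonzero: "adjacency_block Ns G (take r x) (take r y) \<noteq> 0\<^sub>m ?d ?d" if "(x, y) \<in> parcs G" for x y
    proof
      assume "adjacency_block Ns G (take r x) (take r y) = 0\<^sub>m ?d ?d"
      then show False
        using block[OF V[OF that] tk(2)[OF V(1)[OF that]] tk(2)[OF V(2)[OF that]]] that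
          vertex_index_less[OF tk(2)[OF V(1)[OF that]]] vertex_index_less[OF tk(2)[OF V(2)[OF that]]]
        by simp
    qed
    \<comment> \<open>Condition (2) compares the blocks of the arc and of its reverse, which are
      both off-diagonal and nonzero. Reading the common matrix at the suffixes of \<open>u\<close>
      and \<open>v\<close> gives the arc with exchanged prefixes.\<close>
    have "adjacency_block Ns G (take r u) (take r v) = adjacency_block Ns G (take r v) (take r u)"
      using assms(9) r tkuv neq nonzero[OF uv] nonzero[OF sym[OF uv]] by (metis atLeastAtMost_iff)
    then show ?thesis
      using block[OF V[OF uv] tkuv(2,4)] block[OF V(2)[OF uv] V(1)[OF uv] tkuv(2,4)] uv
      by (auto split: if_splits)
  qed
  have "(mix_coords {..<r} u v, mix_coords {..<r} v u) \<in> parcs G"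
    if uv: "(u, v) \<in> parcs G" and r: "r \<le> n" for u v r
  proof -
    \<comment> \<open>The blocks cover levels 1 to \<open>n - 1\<close>. Length 0 changes nothing,
      and length \<open>n\<close> reverses the arc.\<close>
    consider "r = 0" | "1 \<le> r" "r \<le> n - 1" | "r = n"
      using r by linarith
    then show ?thesis
      using len[OF uv] uv prefix[OF uv, of r] sym[OF uv] by cases (auto simp: mix_coords_prefix)
  qed
  then have "(mix_coords T u v, mix_coords T v u) \<in> parcs G" if "(u, v) \<in> parcs G" for u v T
    using mix_coords_closed_if_prefix_closed[OF that len] by blast
  then show ?thesis
    by (rule fully_separable_rho_q_if_closed[OF assms(4-6)])
qed

end
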